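(* Let $p$ be a prime number. For every $F\subset\mathbb{Z}_p$, $$D(\overline{F}\cap\mathbb{Z})\le BD(F),$$ where $\overline{F}$ is the closure of $F$ in $\mathbb{Z}_p$. In particular, $D(E)\le BD(E)$ for every $E\subset\mathbb{Z}$ (with $E$ regarded as a subset of $\mathbb{Z}_p$ on the right-hand side). Moreover, there is a closed set $F\subset\mathbb{Z}_5$ such that $$D(F\cap\mathbb{Z})=BD(F)>\underline{BD}(F)\ge HD(F).$$
   Context: $\mathbb{Z}_p$ is the ring of $p$-adic integers with metric $|x-y|_p$, and $\mathbb{Z}\subset\mathbb{Z}_p$. For $F\subset\mathbb{Z}_p$, let $N_{p^{-n}}(F)$ be the minimum number of balls of radius $p^{-n}$ in $\mathbb{Z}_p$ needed to cover $F$; the upper and lower box-counting dimensions are $BD(F)=\limsup_{n\to\infty}\frac{\log N_{p^{-n}}(F)}{n\log p}$ and $\underline{BD}(F)=\liminf_{n\to\infty}\frac{\log N_{p^{-n}}(F)}{n\log p}$. $HD(F)$ is the Hausdorff dimension of $F$ with respect to the $p$-adic metric. The counting dimension of $E\subset\mathbb{Z}$ is $D(E)=\limsup_{|I|\to\infty}\frac{\log|E\cap I|}{\log|I|}=\lim_{L\to\infty}\sup\{\log|E\cap I|/\log|I|:|I|\ge L\}$, where $I=(M,N]=\{M+1,\dots,N\}$ runs over intervals of integers with $|I|=N-M$. Convention: $\log 0=-\infty$. *)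

theory Defs
  imports "HOL-Analysis.Analysis" "HOL-Algebra.Ring" "HOL-Computational_Algebra.Primes"
begin

section \<open>The ring of \<open>p\<close>-adic integers\<close>

text \<open>
  The ring is the inverse limit of the rings of integers modulo \<open>p ^ n\<close>: a \<open>p\<close>-adic integer is
  the compatible sequence of its canonical residues, \<open>x n\<close> being the residue modulo \<open>p ^ n\<close>.
\<close>

definition padic_int_carrier :: "nat \<Rightarrow> (nat \<Rightarrow> int) set" where
  "padic_int_carrier p =
     {x. \<forall>n. 0 \<le> x n \<and> x n < int p ^ n \<and> x (Suc n) mod int p ^ n = x n}"

definition padic_int :: "nat \<Rightarrow> (nat \<Rightarrow> int) ring" where
  "padic_int p =
     \<lparr>carrier = padic_int_carrier p,
      mult = (\<lambda>x y n. x n * y n mod int p ^ n),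
      one = (\<lambda>n. 1 mod int p ^ n),
      zero = (\<lambda>n. 0),
      add = (\<lambda>x y n. (x n + y n) mod int p ^ n)\<rparr>"

definition padic_of_int :: "nat \<Rightarrow> int \<Rightarrow> (nat \<Rightarrow> int)" where
  "padic_of_int p k = (\<lambda>n. k mod int p ^ n)"

text \<open>
  \<open>x n = 0\<close> means that \<open>p ^ n\<close> divides \<open>x\<close>, so the valuation of a nonzero \<open>x\<close> is the least \<open>n\<close>
  such that \<open>p ^ Suc n\<close> does not divide \<open>x\<close>. Its value at zero is irrelevant.
\<close>

definition padic_val :: "(nat \<Rightarrow> int) \<Rightarrow> nat" where
  "padic_val x = (LEAST n. x (Suc n) \<noteq> 0)"

definition padic_norm :: "nat \<Rightarrow> (nat \<Rightarrow> int) \<Rightarrow> real" where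
  "padic_norm p x = (if x = \<zero>\<^bsub>padic_int p\<^esub> then 0 else 1 / real p ^ padic_val x)"

text \<open>
  The locale of metric spaces requires the distance to be symmetric also outside the carrier, hence
  the default value there.
\<close>

definition padic_dist :: "nat \<Rightarrow> (nat \<Rightarrow> int) \<Rightarrow> (nat \<Rightarrow> int) \<Rightarrow> real" where
  "padic_dist p x y =
     (if x \<in> carrier (padic_int p) \<and> y \<in> carrier (padic_int p)
      then padic_norm p (x \<ominus>\<^bsub>padic_int p\<^esub> y) else 0)"

abbreviation padic_topology :: "nat \<Rightarrow> (nat \<Rightarrow> int) topology" where
  "padic_topology p \<equiv> Metric_space.mtopology (carrier (padic_int p)) (padic_dist p)"


section \<open>Box-counting and Hausdorff dimension\<close>

definition elog :: "nat \<Rightarrow> ereal" where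
  "elog m = (if m = 0 then - \<infinity> else ereal (ln (real m)))"

text \<open>
  Balls are closed, so that a ball of radius \<open>1 / p ^ n\<close> is a residue class modulo \<open>p ^ n\<close> in the
  \<open>p\<close>-adic integers (lemma \<open>padic_mcball\<close> below).
\<close>

definition covering_number :: "'a set \<Rightarrow> ('a \<Rightarrow> 'a \<Rightarrow> real) \<Rightarrow> real \<Rightarrow> 'a set \<Rightarrow> nat" where
  "covering_number M d r F =
     (LEAST k. \<exists>B. finite B \<and> card B = k \<and>
        B \<subseteq> (\<lambda>x. Metric_space.mcball M d x r) ` M \<and> F \<subseteq> \<Union>B)"

definition padic_covering_number :: "nat \<Rightarrow> nat \<Rightarrow> (nat \<Rightarrow> int) set \<Rightarrow> nat" where
  "padic_covering_number p n F =
     covering_number (carrier (padic_int p)) (padic_dist p) (1 / real p ^ n) F"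

definition upper_box_dim :: "nat \<Rightarrow> (nat \<Rightarrow> int) set \<Rightarrow> ereal" where
  "upper_box_dim p F =
     limsup (\<lambda>n. elog (padic_covering_number p n F) / ereal (real n * ln (real p)))"

definition lower_box_dim :: "nat \<Rightarrow> (nat \<Rightarrow> int) set \<Rightarrow> ereal" where
  "lower_box_dim p F =
     liminf (\<lambda>n. elog (padic_covering_number p n F) / ereal (real n * ln (real p)))"

definition set_diam :: "('a \<Rightarrow> 'a \<Rightarrow> real) \<Rightarrow> 'a set \<Rightarrow> ennreal" where
  "set_diam d U = (SUP x\<in>U. SUP y\<in>U. ennreal (d x y))"

text \<open>
  The \<open>s\<close>-th power of a finite diameter. The empty set contributes nothing, and for \<open>s = 0\<close> every
  nonempty set has weight one; this case is separate because \<open>0 powr 0 = 0\<close>.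
\<close>

definition diam_powr :: "('a \<Rightarrow> 'a \<Rightarrow> real) \<Rightarrow> real \<Rightarrow> 'a set \<Rightarrow> ennreal" where
  "diam_powr d s U =
     (if U = {} then 0 else if s = 0 then 1 else ennreal (enn2real (set_diam d U) powr s))"

definition hausdorff_premeasure ::
    "'a set \<Rightarrow> ('a \<Rightarrow> 'a \<Rightarrow> real) \<Rightarrow> real \<Rightarrow> real \<Rightarrow> 'a set \<Rightarrow> ennreal" where
  "hausdorff_premeasure M d s \<delta> F =
     (INF U \<in> {U :: nat \<Rightarrow> 'a set.
         (\<forall>i. U i \<subseteq> M \<and> set_diam d (U i) \<le> ennreal \<delta>) \<and> F \<subseteq> (\<Union>i. U i)}.
       \<Sum>i. diam_powr d s (U i))"

definition hausdorff_measure ::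
    "'a set \<Rightarrow> ('a \<Rightarrow> 'a \<Rightarrow> real) \<Rightarrow> real \<Rightarrow> 'a set \<Rightarrow> ennreal" where
  "hausdorff_measure M d s F = (SUP \<delta>\<in>{0<..}. hausdorff_premeasure M d s \<delta> F)"

definition hausdorff_dim :: "'a set \<Rightarrow> ('a \<Rightarrow> 'a \<Rightarrow> real) \<Rightarrow> 'a set \<Rightarrow> ereal" where
  "hausdorff_dim M d F = Inf {ereal s | s. 0 \<le> s \<and> hausdorff_measure M d s F = 0}"

definition padic_hausdorff_dim :: "nat \<Rightarrow> (nat \<Rightarrow> int) set \<Rightarrow> ereal" where
  "padic_hausdorff_dim p F = hausdorff_dim (carrier (padic_int p)) (padic_dist p) F"


section \<open>Counting dimension of sets of integers\<close>

text \<open>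
  The degenerate quotients with \<open>N - M \<le> 1\<close> and the term \<open>n = 0\<close> of the box-counting dimensions
  above, where the denominator is not positive, do not affect the limits.
\<close>

definition counting_sup :: "int set \<Rightarrow> nat \<Rightarrow> ereal" where
  "counting_sup E L =
     Sup {elog (card (E \<inter> {M<..N})) / elog (card {M<..N}) | M N :: int. card {M<..N} \<ge> L}"

definition counting_dim :: "int set \<Rightarrow> ereal" where
  "counting_dim E = lim (counting_sup E)"

text \<open>The limit in the definition of the counting dimension exists for every set.\<close>

lemma counting_sup_LIMSEQ: "counting_sup E \<longlonglongrightarrow> counting_dim E"
proof -
  have "antimono (counting_sup E)"
    unfolding counting_sup_def by (intro antimonoI Sup_subset_mono) (blast intro: order_trans)
  then have "counting_sup E \<longlonglongrightarrow> (INF L. counting_sup E L)"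
    by (rule LIMSEQ_INF)
  then show ?thesis
    unfolding counting_dim_def by (simp add: limI)
qed


section \<open>Basic facts\<close>

lemma padic_carrier [simp]: "carrier (padic_int p) = padic_int_carrier p"
  and padic_mult: "x \<otimes>\<^bsub>padic_int p\<^esub> y = (\<lambda>n. x n * y n mod int p ^ n)"
  and padic_one: "\<one>\<^bsub>padic_int p\<^esub> = (\<lambda>n. 1 mod int p ^ n)"
  and padic_zero: "\<zero>\<^bsub>padic_int p\<^esub> = (\<lambda>n. 0)"
  and padic_add: "x \<oplus>\<^bsub>padic_int p\<^esub> y = (\<lambda>n. (x n + y n) mod int p ^ n)"
  by (simp_all add: padic_int_def)

lemma padic_int_carrierI:
  assumes "p > 0" and "\<And>n. f (Suc n) mod int p ^ n = f n mod int p ^ n"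
  shows "(\<lambda>n. f n mod int p ^ n) \<in> padic_int_carrier p"
  using assms by (auto simp: padic_int_carrier_def mod_mod_cancel)

lemma padic_int_carrierD:
  assumes "x \<in> padic_int_carrier p"
  shows "x n mod int p ^ n = x n" "x (Suc n) mod int p ^ n = x n"
  using assms by (auto simp: padic_int_carrier_def)

lemma padic_of_int_in_carrier: "p > 0 \<Longrightarrow> padic_of_int p k \<in> carrier (padic_int p)"
  unfolding padic_of_int_def padic_carrier by (rule padic_int_carrierI) auto

lemma padic_int_abelian_group:
  assumes "p > 0" shows "abelian_group (padic_int p)"
proof (rule abelian_groupI)
  fix x y assume xy: "x \<in> carrier (padic_int p)" "y \<in> carrier (padic_int p)"
  show "x \<oplus>\<^bsub>padic_int p\<^esub> y \<in> carrier (padic_int p)"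
    unfolding padic_add padic_carrier using assms xy
    by (intro padic_int_carrierI)
      (auto simp: padic_int_carrierD intro: mod_add_cong)
next
  show "\<zero>\<^bsub>padic_int p\<^esub> \<in> carrier (padic_int p)"
    using assms by (auto simp: padic_zero padic_int_carrier_def)
next
  fix x assume x: "x \<in> carrier (padic_int p)"
  have "(\<lambda>n. (- x n) mod int p ^ n) \<in> carrier (padic_int p)"
    unfolding padic_carrier using assms x
    by (intro padic_int_carrierI) (auto simp: padic_int_carrierD intro: mod_minus_cong)
  then show "\<exists>y\<in>carrier (padic_int p). y \<oplus>\<^bsub>padic_int p\<^esub> x = \<zero>\<^bsub>padic_int p\<^esub>"
    by (rule bexI[rotated]) (auto simp: padic_add padic_zero mod_add_left_eq)
  show "\<zero>\<^bsub>padic_int p\<^esub> \<oplus>\<^bsub>padic_int p\<^esub> x = x"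
    using x by (auto simp: padic_add padic_zero padic_int_carrierD)
qed (auto simp: padic_add mod_simps algebra_simps)

lemma padic_int_cring:
  assumes "p > 0" shows "cring (padic_int p)"
proof (rule cringI)
  show "abelian_group (padic_int p)" by (rule padic_int_abelian_group[OF assms])
  show "comm_monoid (padic_int p)"
  proof (rule comm_monoidI)
    fix x y assume xy: "x \<in> carrier (padic_int p)" "y \<in> carrier (padic_int p)"
    show "x \<otimes>\<^bsub>padic_int p\<^esub> y \<in> carrier (padic_int p)"
      unfolding padic_mult padic_carrier using assms xy
      by (intro padic_int_carrierI)
        (auto simp: padic_int_carrierD intro: mod_mult_cong)
  next
    show "\<one>\<^bsub>padic_int p\<^esub> \<in> carrier (padic_int p)"
      unfolding padic_one padic_carrier by (intro padic_int_carrierI) (auto simp: assms)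
  next
    fix x assume "x \<in> carrier (padic_int p)"
    then show "\<one>\<^bsub>padic_int p\<^esub> \<otimes>\<^bsub>padic_int p\<^esub> x = x"
      by (auto simp: padic_mult padic_one mod_mult_left_eq padic_int_carrierD)
  qed (auto simp: padic_mult mod_simps algebra_simps)
qed (auto simp: padic_mult padic_add mod_simps algebra_simps)

lemma padic_minus:
  assumes "p > 0" "x \<in> carrier (padic_int p)" "y \<in> carrier (padic_int p)"
  shows "x \<ominus>\<^bsub>padic_int p\<^esub> y = (\<lambda>n. (x n - y n) mod int p ^ n)"
proof -
  interpret abelian_group "padic_int p" by (rule padic_int_abelian_group[OF assms(1)])
  let ?m = "\<lambda>n. (- y n) mod int p ^ n"
  have m: "?m \<in> carrier (padic_int p)"
    unfolding padic_carrier using assms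
    by (intro padic_int_carrierI) (auto simp: padic_int_carrierD intro: mod_minus_cong)
  have "?m \<oplus>\<^bsub>padic_int p\<^esub> y = \<zero>\<^bsub>padic_int p\<^esub>"
    by (auto simp: padic_add padic_zero mod_add_left_eq)
  then have "\<ominus>\<^bsub>padic_int p\<^esub> y = ?m"
    using m assms(3) by (intro minus_equality) auto
  then show ?thesis
    by (simp add: a_minus_def padic_add mod_add_right_eq)
qed

lemma padic_dist_le_iff:
  assumes p: "p > 1" and x: "x \<in> carrier (padic_int p)" and y: "y \<in> carrier (padic_int p)"
  shows "padic_dist p x y \<le> 1 / real p ^ n \<longleftrightarrow> x n = y n"
proof -
  define z where "z = x \<ominus>\<^bsub>padic_int p\<^esub> y"
  have zn: "z n = (x n - y n) mod int p ^ n" for n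
    using padic_minus[of p x y] assms by (simp add: z_def)
  have z0: "z n = 0 \<longleftrightarrow> x n = y n" for n
    using x y by (metis zn mod_eq_dvd_iff mod_eq_0_iff_dvd padic_carrier padic_int_carrierD(1))
  have step: "z n = 0" if "z (Suc n) = 0" for n
    using that x y unfolding z0 by (metis padic_carrier padic_int_carrierD(2))
  have down: "z m = 0" if "m \<le> n" "z n = 0" for m n
    using that by (induction rule: inc_induct) (auto intro: step)
  show ?thesis
  proof (cases "z = (\<lambda>n. 0)")
    case True
    then have "x n = y n" by (simp flip: z0)
    then show ?thesis
      using True by (simp add: padic_dist_def x[simplified] y[simplified] padic_norm_def padic_zero z0 flip: z_def)
  next
    case False
    then obtain k where "z k \<noteq> 0" by auto
    moreover have "z 0 = 0" by (simp add: zn)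
    ultimately have ex: "\<exists>k. z (Suc k) \<noteq> 0" by (metis not0_implies_Suc)
    have v1: "z (Suc (padic_val z)) \<noteq> 0"
      unfolding padic_val_def using ex by (rule LeastI_ex)
    have v2: "z (padic_val z) = 0"
    proof (cases "padic_val z")
      case (Suc k)
      then have "k < (LEAST n. z (Suc n) \<noteq> 0)" unfolding padic_val_def by simp
      from not_less_Least[OF this] show ?thesis using Suc by simp
    qed (use \<open>z 0 = 0\<close> in simp)
    have "padic_dist p x y = 1 / real p ^ padic_val z"
      using False by (simp add: padic_dist_def x[simplified] y[simplified] padic_norm_def padic_zero flip: z_def)
    also have "\<dots> \<le> 1 / real p ^ n \<longleftrightarrow> n \<le> padic_val z"
      using p by (simp add: field_simps)
    also have "\<dots> \<longleftrightarrow> z n = 0"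
      using v1 v2 down by (meson not_less_eq_eq)
    finally show ?thesis by (simp add: z0)
  qed
qed

lemma padic_dist_nonneg: "0 \<le> padic_dist p x y"
  by (simp add: padic_dist_def padic_norm_def)

lemma padic_dist_values: "padic_dist p x y = 0 \<or> (\<exists>n. padic_dist p x y = 1 / real p ^ n)"
  by (auto simp: padic_dist_def padic_norm_def)

lemma padic_dist_0_iff:
  assumes p: "p > 1" and x: "x \<in> carrier (padic_int p)" and y: "y \<in> carrier (padic_int p)"
  shows "padic_dist p x y = 0 \<longleftrightarrow> x = y"
proof
  assume "padic_dist p x y = 0"
  then have "padic_dist p x y \<le> 1 / real p ^ n" for n by simp
  then show "x = y" using padic_dist_le_iff[OF assms] by blast
next
  assume "x = y"
  then show "padic_dist p x y = 0"
    using padic_minus[of p x y] x y p by (simp add: padic_dist_def padic_norm_def padic_zero)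
qed

lemma padic_dist_leI:
  assumes p: "p > 1" and x: "x \<in> carrier (padic_int p)" and y: "y \<in> carrier (padic_int p)"
    and r: "r = 0 \<or> (\<exists>n. r = 1 / real p ^ n)" and eq: "\<And>n. r \<le> 1 / real p ^ n \<Longrightarrow> x n = y n"
  shows "padic_dist p x y \<le> r"
  using r
proof
  assume "r = 0"
  then have "x = y" using eq by auto
  then show ?thesis using padic_dist_0_iff[OF p x y] \<open>r = 0\<close> by simp
next
  assume "\<exists>n. r = 1 / real p ^ n"
  then obtain n where n: "r = 1 / real p ^ n" by blast
  then have "x n = y n" by (intro eq) simp
  then show ?thesis unfolding n using padic_dist_le_iff[OF p x y] by blast
qed

lemma padic_metric_space:
  assumes "prime p"
  shows "Metric_space (carrier (padic_int p)) (padic_dist p)"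
proof
  have p: "p > 1" using assms by (rule prime_gt_1_nat)
  show "0 \<le> padic_dist p x y" for x y by (rule padic_dist_nonneg)
  have comm_le: "padic_dist p x y \<le> padic_dist p y x" for x y
  proof (cases "x \<in> carrier (padic_int p) \<and> y \<in> carrier (padic_int p)")
    case True
    then have x: "x \<in> carrier (padic_int p)" and y: "y \<in> carrier (padic_int p)" by auto
    show ?thesis
    proof (rule padic_dist_leI[OF p x y padic_dist_values])
      fix n assume "padic_dist p y x \<le> 1 / real p ^ n"
      then show "x n = y n" using padic_dist_le_iff[OF p y x] by metis
    qed
  qed (auto simp: padic_dist_def)
  show "padic_dist p x y = padic_dist p y x" for x y
    using comm_le by (intro antisym)
  show "padic_dist p x y = 0 \<longleftrightarrow> x = y"
    if "x \<in> carrier (padic_int p)" "y \<in> carrier (padic_int p)" for x y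
    by (rule padic_dist_0_iff[OF p that])
  show "padic_dist p x z \<le> padic_dist p x y + padic_dist p y z"
    if x: "x \<in> carrier (padic_int p)" and y: "y \<in> carrier (padic_int p)"
      and z: "z \<in> carrier (padic_int p)" for x y z
  proof -
    have "padic_dist p x z \<le> max (padic_dist p x y) (padic_dist p y z)"
    proof (rule padic_dist_leI[OF p x z])
      show "max (padic_dist p x y) (padic_dist p y z) = 0 \<or>
            (\<exists>n. max (padic_dist p x y) (padic_dist p y z) = 1 / real p ^ n)"
        using padic_dist_values[of p x y] padic_dist_values[of p y z] unfolding max_def by metis
      show "x n = z n"
        if "max (padic_dist p x y) (padic_dist p y z) \<le> 1 / real p ^ n" for n
        using that padic_dist_le_iff[OF p x y] padic_dist_le_iff[OF p y z] by simp
    qed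
    then show ?thesis using padic_dist_nonneg[of p x y] padic_dist_nonneg[of p y z] by linarith
  qed
qed

lemma padic_mcball:
  assumes "prime p" "x \<in> carrier (padic_int p)"
  shows "Metric_space.mcball (carrier (padic_int p)) (padic_dist p) x (1 / real p ^ n) =
           {y \<in> carrier (padic_int p). y n = x n}"
  using padic_dist_le_iff[OF prime_gt_1_nat] assms
  by (auto simp: Metric_space.mcball_def[OF padic_metric_space] simp del: padic_carrier)

text \<open>Only finitely many balls have a given radius, so the covering numbers are attained.\<close>

lemma padic_covering_number_attained:
  assumes p: "prime p" and F: "F \<subseteq> carrier (padic_int p)"
  shows "\<exists>B. finite B \<and> card B = padic_covering_number p n F \<and>
           B \<subseteq> (\<lambda>x. Metric_space.mcball (carrier (padic_int p)) (padic_dist p) x (1 / real p ^ n)) `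
                 carrier (padic_int p) \<and> F \<subseteq> \<Union>B"
proof -
  let ?b = "\<lambda>x. Metric_space.mcball (carrier (padic_int p)) (padic_dist p) x (1 / real p ^ n)"
  let ?B = "?b ` carrier (padic_int p)"
  have "?B \<subseteq> (\<lambda>a. {y \<in> carrier (padic_int p). y n = a}) ` {0..<int p ^ n}"
  proof (clarify, rule image_eqI)
    fix x assume x: "x \<in> carrier (padic_int p)"
    show "?b x = {y \<in> carrier (padic_int p). y n = x n}" by (rule padic_mcball[OF p x])
    show "x n \<in> {0..<int p ^ n}" using x by (simp add: padic_int_carrier_def)
  qed
  then have "finite ?B" by (rule finite_subset) auto
  moreover have "F \<subseteq> \<Union>?B"
  proof
    fix x assume "x \<in> F"
    with F have x: "x \<in> carrier (padic_int p)" by blast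
    then have "x \<in> ?b x" unfolding padic_mcball[OF p x] by blast
    with x show "x \<in> \<Union>?B" by blast
  qed
  ultimately have "\<exists>k B. finite B \<and> card B = k \<and> B \<subseteq> ?B \<and> F \<subseteq> \<Union>B" by blast
  then show ?thesis
    unfolding padic_covering_number_def covering_number_def by (rule LeastI_ex)
qed

end

theory Submission
  imports Defs "HOL-Real_Asymp.Real_Asymp"
begin

text \<open>
  The covering number at scale \<open>p ^ -n\<close> is the number of residues modulo \<open>p ^ n\<close>, which does not
  change on passing to the closure. The integers of an interval of length at most \<open>p ^ n\<close> have
  distinct residues, so an interval \<open>I\<close> with \<open>p ^ (n - 1) < |I| \<le> p ^ n\<close> contains at most that many
  points of the closure, and \<open>ln |I|\<close> differs from \<open>n * ln p\<close> by at most \<open>ln p\<close>.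

  For the example take \<open>0\<close> together with the blocks \<open>p ^ m * j\<close>, \<open>1 \<le> j \<le> p ^ (k * m)\<close>, for rapidly
  growing \<open>m = m k\<close>. The only accumulation point is \<open>0\<close>, so the set is closed and countable and has
  Hausdorff dimension \<open>0\<close>. The \<open>k\<close>-th block fills \<open>p ^ (k * m)\<close> places of an interval of length
  \<open>p ^ ((k + 1) * m)\<close>, which makes the counting dimension \<open>1\<close>; but modulo \<open>p ^ m (k + 1)\<close> only the
  blocks up to the \<open>k\<close>-th survive, and they lie below the square root of this modulus.
\<close>

section \<open>Covering numbers and closures in terms of residues\<close>

lemma elog_mono: "m \<le> n \<Longrightarrow> elog m \<le> elog n"
  by (auto simp: elog_def)

lemma finite_padic_residues: "F \<subseteq> carrier (padic_int p) \<Longrightarrow> finite ((\<lambda>x. x n) ` F)"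
  by (rule finite_subset[of _ "{0..<int p ^ n}"]) (auto simp: padic_int_carrier_def)

text \<open>The classes of the occurring residues cover \<open>F\<close>. Conversely, a ball of a
  cover is a single residue class modulo \<open>p ^ n\<close>, so each residue of \<open>F\<close>
  needs a ball of its own.\<close>

lemma padic_covering_number_eq_card:
  assumes p: "prime p" and F: "F \<subseteq> carrier (padic_int p)"
  shows "padic_covering_number p n F = card ((\<lambda>x. x n) ` F)"
proof (rule antisym)
  let ?ball = "\<lambda>x. Metric_space.mcball (carrier (padic_int p)) (padic_dist p) x (1 / real p ^ n)"
  let ?cls = "\<lambda>a. {y \<in> carrier (padic_int p). y n = a}"
  let ?R = "(\<lambda>x. x n) ` F"
  have fin: "finite ?R" by (rule finite_padic_residues[OF F])
  have "?cls ` ?R \<subseteq> ?ball ` carrier (padic_int p)"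
  proof clarify
    fix x assume "x \<in> F"
    with F have x: "x \<in> carrier (padic_int p)" by blast
    show "?cls (x n) \<in> ?ball ` carrier (padic_int p)"
      using padic_mcball[OF p x, of n] x by (metis (no_types, lifting) imageI)
  qed
  moreover have "F \<subseteq> \<Union>(?cls ` ?R)" using F by auto
  ultimately have "padic_covering_number p n F \<le> card (?cls ` ?R)"
    unfolding padic_covering_number_def covering_number_def
    by (intro Least_le exI[of _ "?cls ` ?R"] conjI) (use fin in auto)
  also have "\<dots> \<le> card ?R" using fin by (rule card_image_le)
  finally show "padic_covering_number p n F \<le> card ?R" .
next
  let ?ball = "\<lambda>x. Metric_space.mcball (carrier (padic_int p)) (padic_dist p) x (1 / real p ^ n)"
  let ?R = "(\<lambda>x. x n) ` F"
  obtain B where B: "finite B" "card B = padic_covering_number p n F"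
      "B \<subseteq> ?ball ` carrier (padic_int p)" "F \<subseteq> \<Union>B"
    using padic_covering_number_attained[OF p F, of n] by (elim exE conjE) (rule that)
  have const: "x n = y n" if "b \<in> B" "x \<in> b" "y \<in> b" for b x y
  proof -
    obtain c where c: "c \<in> carrier (padic_int p)" "b = ?ball c" using subsetD[OF B(3) \<open>b \<in> B\<close>] by (elim imageE) (rule that)
    show ?thesis using that(2,3) unfolding c(2) padic_mcball[OF p c(1)] mem_Collect_eq by metis
  qed
  \<comment> \<open>By \<open>const\<close> every point of a ball has the same residue, so the
    arbitrary choice by \<open>SOME\<close> reads off the residue of the whole ball.\<close>
  have "?R \<subseteq> (\<lambda>b. (SOME x. x \<in> b) n) ` B"
  proof clarify
    fix x assume "x \<in> F"
    then obtain b where b: "b \<in> B" "x \<in> b" using B(4) by blast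
    then have "x n = (SOME x. x \<in> b) n" using const[OF b(1)] by (metis someI)
    then show "x n \<in> (\<lambda>b. (SOME x. x \<in> b) n) ` B" using b(1) by blast
  qed
  then have "card ?R \<le> card B" by (rule surj_card_le[OF B(1)])
  then show "card ?R \<le> padic_covering_number p n F" using B(2) by simp
qed

lemma padic_covering_number_pos:
  assumes "prime p" "F \<subseteq> carrier (padic_int p)" "F \<noteq> {}"
  shows "0 < padic_covering_number p n F"
  using assms finite_padic_residues[of F p n] by (simp add: padic_covering_number_eq_card card_gt_0_iff)

lemma padic_covering_number_le:
  assumes "prime p" "F \<subseteq> carrier (padic_int p)"
  shows "padic_covering_number p n F \<le> p ^ n"
proof -
  have "card ((\<lambda>x. x n) ` F) \<le> card {0..<int p ^ n}"
    by (rule card_mono) (use assms in \<open>auto simp: padic_int_carrier_def\<close>)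
  then show ?thesis
    using assms by (simp add: padic_covering_number_eq_card nat_power_eq)
qed

text \<open>Being within \<open>1 / p ^ n\<close> of \<open>x\<close> means agreeing with
  \<open>x\<close> at level \<open>n\<close>, and these radii are arbitrarily small.\<close>

lemma padic_in_closure_of_iff:
  assumes p: "prime p" and F: "F \<subseteq> carrier (padic_int p)"
  shows "x \<in> padic_topology p closure_of F \<longleftrightarrow> x \<in> carrier (padic_int p) \<and> (\<forall>n. \<exists>y\<in>F. y n = x n)"
proof -
  interpret Metric_space "carrier (padic_int p)" "padic_dist p" by (rule padic_metric_space[OF p])
  have p1: "p > 1" using p by (rule prime_gt_1_nat)
  have "(\<forall>r>0. \<exists>y\<in>F. padic_dist p x y < r) \<longleftrightarrow> (\<forall>n. \<exists>y\<in>F. y n = x n)"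
    if x: "x \<in> carrier (padic_int p)"
  proof safe
    fix n assume *: "\<forall>r>0. \<exists>y\<in>F. padic_dist p x y < r"
    have "1 / real p ^ n > 0" using p1 by simp
    with * obtain y where "y \<in> F" "padic_dist p x y < 1 / real p ^ n" by blast
    then show "\<exists>y\<in>F. y n = x n"
      using padic_dist_le_iff[OF p1 x, of y n] F by (metis less_imp_le subsetD)
  next
    fix r :: real assume *: "\<forall>n. \<exists>y\<in>F. y n = x n" and "r > 0"
    obtain n where n: "(1 / real p) ^ n < r"
      using real_arch_pow_inv[OF \<open>r > 0\<close>, of "1 / real p"] p1 by auto
    obtain y where y: "y \<in> F" "y n = x n" using * by blast
    then have "padic_dist p x y \<le> 1 / real p ^ n"
      using padic_dist_le_iff[OF p1 x, of y n] F by (metis subsetD)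
    also have "\<dots> < r" using n by (simp add: power_one_over)
    finally show "\<exists>y\<in>F. padic_dist p x y < r" using y(1) by blast
  qed
  then show ?thesis
    unfolding metric_closure_of in_mball using F by blast
qed

section \<open>Counting dimension against upper box dimension\<close>

text \<open>The assumption on \<open>E\<close> is shared by the integers in the closure of
  \<open>F\<close> and by a set of integers whose image is \<open>F\<close>. Each real
  \<open>c\<close> above the upper box dimension bounds \<open>counting_sup E L\<close> up to an
  error of order \<open>1 / ln L\<close>.\<close>

lemma counting_dim_le_upper_box_dim:
  assumes p: "prime p" and F: "F \<subseteq> carrier (padic_int p)"
    and E: "\<And>k n. k \<in> E \<Longrightarrow> k mod int p ^ n \<in> (\<lambda>x. x n) ` F"
  shows "counting_dim E \<le> upper_box_dim p F"
proof (cases "F = {}")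
  case True
  with E have "E = {}" by blast
  \<comment> \<open>With \<open>L \<ge> 2\<close> the denominator is a positive real, so the
    quotient for the empty set really is \<open>-\<infinity>\<close>.\<close>
  have "counting_sup E L \<le> -\<infinity>" if L: "L \<ge> 2" for L
    unfolding counting_sup_def
  proof (rule Sup_least, clarify)
    fix M N :: int assume "L \<le> card {M<..N}"
    then have "0 < elog (card {M<..N})" "elog (card {M<..N}) < \<infinity>" using L by (auto simp: elog_def)
    then show "elog (card (E \<inter> {M<..N})) / elog (card {M<..N}) \<le> -\<infinity>"
      using \<open>E = {}\<close> by (subst ereal_divide_le_pos) (auto simp: elog_def)
  qed
  then have "counting_sup E L = -\<infinity>" if "L \<ge> 2" for L
    using that by (simp only: ereal_infty_less_eq)
  then have "counting_sup E \<longlonglongrightarrow> -\<infinity>"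
    by (intro tendsto_eventually eventually_sequentiallyI[of 2])
  then have "counting_dim E = -\<infinity>" by (rule LIMSEQ_unique[OF counting_sup_LIMSEQ])
  then show ?thesis by simp
next
  case False
  have p1: "p > 1" using p by (rule prime_gt_1_nat)
  then have lp: "ln (real p) > 0" by simp
  let ?N = "\<lambda>n. padic_covering_number p n F"
  have N: "?N n > 0" for n by (rule padic_covering_number_pos[OF p F False])
  have le: "counting_dim E \<le> ereal c" if c: "upper_box_dim p F < ereal c" for c
  proof -
    obtain n0 where n0: "elog (?N n) / ereal (real n * ln (real p)) < ereal c" if "n \<ge> n0" for n
      using Limsup_lessD[OF c[unfolded upper_box_dim_def]] unfolding eventually_sequentially by blast
    have lnN: "ln (real (?N n)) < c * (real n * ln (real p))" if "n \<ge> n0" "n > 0" for n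
      using n0[OF that(1)] N[of n] that(2) lp by (simp add: elog_def field_simps)
    \<comment> \<open>A nonempty set needs at least one ball, which forces \<open>c > 0\<close>;
      later inequalities are multiplied by \<open>c\<close>. The index \<open>Suc n0\<close> avoids
      the degenerate scale \<open>0\<close>.\<close>
    have "0 \<le> ln (real (?N (Suc n0)))" using N[of "Suc n0"] by simp
    with lnN[of "Suc n0"] have "0 < c * (real (Suc n0) * ln (real p))" by linarith
    then have c0: "c > 0" by (rule zero_less_mult_pos2) (use lp in \<open>simp del: of_nat_Suc\<close>)
    \<comment> \<open>The bound \<open>p ^ n0 \<le> L\<close> ensures that the scale
      \<open>n\<close> chosen for an interval is at least \<open>n0\<close>, where
      \<open>lnN\<close> applies.\<close>
    have "counting_sup E L \<le> ereal (c + c * ln (real p) / ln (real L))"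
      if L: "L \<ge> max 2 (p ^ n0)" for L
      unfolding counting_sup_def
    proof (rule Sup_least, clarify)
      fix M N' :: int
      define l where "l = card {M<..N'}"
      assume "L \<le> card {M<..N'}"
      then have lL: "L \<le> l" by (simp add: l_def)
      \<comment> \<open>Minimality serves both sides: \<open>l \<le> p ^ n\<close> makes reduction
        injective on the interval, and \<open>p ^ (n - 1) < l\<close> bounds \<open>n * ln p\<close>
        in terms of \<open>ln l\<close>.\<close>
      define n where "n = (LEAST n. l \<le> p ^ n)"
      have ex: "\<exists>n. l \<le> p ^ n" using power_gt_expt[of p l] p1 by (intro exI[of _ l]) simp
      have ln: "l \<le> p ^ n" unfolding n_def by (rule LeastI_ex[OF ex])
      have n_pos: "n > 0" using ln lL L by (cases n) auto
      have pn: "p ^ (n - 1) < l"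
        using not_less_Least[of "n - 1" "\<lambda>n. l \<le> p ^ n"] n_pos by (simp add: n_def[symmetric])
      have "p ^ n0 \<le> p ^ n" using ln lL L by linarith
      then have nn0: "n \<ge> n0" using p1 by (simp add: power_increasing_iff)
      have "inj_on (\<lambda>k. k mod int p ^ n) (E \<inter> {M<..N'})"
      proof (rule inj_onI)
        fix a b assume ab: "a \<in> E \<inter> {M<..N'}" "b \<in> E \<inter> {M<..N'}"
          and "a mod int p ^ n = b mod int p ^ n"
        then have dvd: "int p ^ n dvd a - b" by (simp add: mod_eq_dvd_iff)
        have "int l \<le> int p ^ n" using ln by (metis of_nat_le_iff of_nat_power)
        moreover have "\<bar>a - b\<bar> < int l" using ab by (auto simp: l_def)
        moreover have "int p ^ n \<le> \<bar>a - b\<bar>" if "a \<noteq> b" using dvd_imp_le_int[OF _ dvd] that by simp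
        ultimately show "a = b" by (meson not_le order_trans)
      qed
      then have "card (E \<inter> {M<..N'}) = card ((\<lambda>k. k mod int p ^ n) ` (E \<inter> {M<..N'}))"
        by (simp add: card_image)
      also have "\<dots> \<le> card ((\<lambda>x. x n) ` F)"
        by (rule card_mono[OF finite_padic_residues[OF F]]) (use E in blast)
      finally have cardle: "card (E \<inter> {M<..N'}) \<le> ?N n"
        by (simp add: padic_covering_number_eq_card[OF p F])
      have l2: "real l \<ge> 2" "real L \<ge> 2" using lL L by auto
      then have lnl: "ln (real l) > 0" "ln (real L) > 0" "ln (real L) \<le> ln (real l)" using lL by auto
      have "ln (real (p ^ (n - 1))) < ln (real l)"
        using pn p1 by (subst ln_less_cancel_iff) (auto intro: zero_less_power)
      then have "(real n - 1) * ln (real p) < ln (real l)"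
        using p1 n_pos by (simp add: ln_realpow of_nat_diff)
      then have "real n * ln (real p) \<le> ln (real l) + ln (real p)" by (simp add: algebra_simps)
      then have "c * (real n * ln (real p)) \<le> c * (ln (real l) + ln (real p))"
        using c0 by (intro mult_left_mono) auto
      then have "ln (real (?N n)) \<le> c * (ln (real l) + ln (real p))"
        using lnN[OF nn0 n_pos] by linarith
      then have "ln (real (?N n)) / ln (real l) \<le> c + c * ln (real p) / ln (real l)"
        using lnl by (simp add: field_simps)
      also have "\<dots> \<le> c + c * ln (real p) / ln (real L)"
        using lnl c0 lp by (intro add_left_mono divide_left_mono) auto
      finally have *: "elog (?N n) / elog l \<le> ereal (c + c * ln (real p) / ln (real L))"
        using N[of n] l2 lnl by (simp add: elog_def)
      have "elog (card (E \<inter> {M<..N'})) / elog l \<le> elog (?N n) / elog l"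
        using elog_mono[OF cardle] l2 lnl by (intro ereal_divide_right_mono) (auto simp: elog_def)
      with * show "elog (card (E \<inter> {M<..N'})) / elog (card {M<..N'})
          \<le> ereal (c + c * ln (real p) / ln (real L))"
        unfolding l_def by (rule order_trans[rotated])
    qed
    moreover have "(\<lambda>L. ereal (c + c * ln (real p) / ln (real L))) \<longlonglongrightarrow> ereal c"
      by (intro tendsto_ereal) real_asymp
    ultimately show ?thesis
      by (intro LIMSEQ_le[OF counting_sup_LIMSEQ]) blast+
  qed
  \<comment> \<open>The estimate \<open>le\<close> concerns real \<open>c\<close> only, so a real
    strictly between the two dimensions is used.\<close>
  show ?thesis
  proof (rule ccontr)
    assume "\<not> ?thesis"
    then obtain c where "upper_box_dim p F < ereal c" "ereal c < counting_dim E"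
      using ereal_dense2 by (meson not_le)
    with le show False by (meson not_le)
  qed
qed

section \<open>General bounds for box and Hausdorff dimensions\<close>

lemma upper_box_dim_le_1:
  assumes p: "prime p" and F: "F \<subseteq> carrier (padic_int p)"
  shows "upper_box_dim p F \<le> 1"
  unfolding upper_box_dim_def
proof (rule Limsup_bounded, rule eventually_sequentiallyI[of 1])
  fix n :: nat assume n: "n \<ge> 1"
  have p1: "p > 1" using p by (rule prime_gt_1_nat)
  have "elog (padic_covering_number p n F) \<le> elog (p ^ n)"
    by (rule elog_mono[OF padic_covering_number_le[OF p F]])
  also have "\<dots> = ereal (real n * ln (real p))" using p1 by (simp add: elog_def ln_realpow)
  finally show "elog (padic_covering_number p n F) / ereal (real n * ln (real p)) \<le> 1"
    using n p1 by (subst ereal_divide_le_pos) auto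
qed

lemma lower_box_dim_nonneg:
  assumes p: "prime p" and F: "F \<subseteq> carrier (padic_int p)" "F \<noteq> {}"
  shows "0 \<le> lower_box_dim p F"
  unfolding lower_box_dim_def
proof (rule Liminf_bounded, rule eventually_sequentiallyI[of 1])
  fix n :: nat assume n: "n \<ge> 1"
  have p1: "p > 1" using p by (rule prime_gt_1_nat)
  have "padic_covering_number p n F > 0" by (rule padic_covering_number_pos[OF p F])
  then have "elog (padic_covering_number p n F) = ereal (ln (real (padic_covering_number p n F)))"
    "0 \<le> ln (real (padic_covering_number p n F))"
    by (simp_all add: elog_def)
  then show "0 \<le> elog (padic_covering_number p n F) / ereal (real n * ln (real p))"
    using n p1 by simp
qed

text \<open>Singletons have diameter \<open>0\<close>, hence weight \<open>0\<close> for every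
  \<open>s > 0\<close>, and countably many of them cover \<open>F\<close>. At \<open>s = 0\<close> a
  singleton has weight one, so the bound is reached by letting \<open>s\<close> tend to
  \<open>0\<close>.\<close>

lemma (in Metric_space) hausdorff_dim_countable:
  assumes F: "F \<subseteq> M" "countable F"
  shows "hausdorff_dim M d F \<le> 0"
proof -
  have "hausdorff_measure M d s F = 0" if s: "s > 0" for s
  proof -
    \<comment> \<open>For empty \<open>F\<close> the value of \<open>from_nat_into\<close> is
      arbitrary and might lie outside \<open>M\<close>; for finite \<open>F\<close> the enumeration
      repeats points, which is harmless at weight \<open>0\<close>.\<close>
    define U where "U i = (if F = {} then {} else {from_nat_into F i})" for i
    have U: "U i \<subseteq> M" "set_diam d (U i) = 0" for i
      using F(1) from_nat_into[of F i] by (auto simp: U_def set_diam_def bot_ennreal subset_iff)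
    have "diam_powr d s (U i) = 0" for i
      using U(2) s by (simp add: diam_powr_def)
    then have sum: "(\<Sum>i. diam_powr d s (U i)) = 0" by simp
    have cover: "F \<subseteq> (\<Union>i. U i)"
      using from_nat_into_surj[OF F(2)] by (fastforce simp: U_def)
    have "hausdorff_premeasure M d s \<delta> F \<le> 0" for \<delta>
      unfolding hausdorff_premeasure_def
      by (rule INF_lower2[of U]) (use U cover sum in auto)
    then show ?thesis by (simp add: hausdorff_measure_def)
  qed
  then have "hausdorff_dim M d F \<le> ereal s" if "s > 0" for s
    unfolding hausdorff_dim_def using that by (intro Inf_lower) force
  then show ?thesis
    by (metis ereal_le_epsilon2 add_0)
qed

section \<open>The example built from sparse blocks\<close>

text \<open>The solution of \<open>block_exp (Suc k) = 4 * (Suc k * block_exp k)\<close> with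
  initial value \<open>1\<close>: block \<open>k\<close> reaches up to
  \<open>p ^ (Suc k * block_exp k)\<close>, and the next exponent is four times as large as this
  one.\<close>

definition block_exp :: "nat \<Rightarrow> nat" where
  "block_exp k = 4 ^ k * fact k"

definition block :: "nat \<Rightarrow> nat \<Rightarrow> int set" where
  "block p k = (\<lambda>j. int p ^ block_exp k * j) ` {1..int p ^ (k * block_exp k)}"

definition block_union :: "nat \<Rightarrow> int set" where
  "block_union p = insert 0 (\<Union>k. block p k)"

lemma block_exp_Suc: "block_exp (Suc k) = 4 * (Suc k * block_exp k)"
  by (simp add: block_exp_def algebra_simps)

lemma block_exp_pos: "block_exp k > 0"
  by (simp add: block_exp_def)

lemma block_exp_mono: "i \<le> j \<Longrightarrow> block_exp i \<le> block_exp j"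
  by (auto simp: block_exp_def intro!: mult_mono power_increasing fact_mono)

lemma block_exp_ge: "k \<le> block_exp k"
proof (induction k)
  case (Suc k)
  then show ?case using block_exp_pos[of k] by (simp add: block_exp_Suc)
qed simp

text \<open>A number divisible by all powers of \<open>p\<close> is \<open>0\<close>. Injectivity
  ensures that the integers in the image of \<open>block_union p\<close> are exactly its
  elements.\<close>

lemma padic_of_int_inj:
  assumes "p > 1" shows "inj (padic_of_int p)"
proof (rule injI)
  fix a b assume "padic_of_int p a = padic_of_int p b"
  then have *: "int p ^ n dvd a - b" for n
    by (simp add: padic_of_int_def fun_eq_iff mod_eq_dvd_iff)
  define n where "n = nat \<bar>a - b\<bar>"
  have "int n < int (p ^ n)" using power_gt_expt[of p n] assms by (simp only: of_nat_less_iff)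
  then have "\<bar>a - b\<bar> < int p ^ n" by (simp add: n_def)
  then show "a = b" using dvd_imp_le_int[OF _ *[of n]] by (cases "a = b") simp_all
qed

text \<open>A nonzero \<open>x\<close> has \<open>x n \<noteq> 0\<close> for some \<open>n\<close>,
  and only finitely many points of the set have a nonzero residue at that level. If \<open>x\<close>
  is none of them, a finer level separates it from all.\<close>

lemma closedin_block_union:
  assumes p: "prime p"
  shows "closedin (padic_topology p) (padic_of_int p ` block_union p)"
proof -
  interpret Metric_space "carrier (padic_int p)" "padic_dist p" by (rule padic_metric_space[OF p])
  have p1: "p > 1" using p by (rule prime_gt_1_nat)
  let ?F = "padic_of_int p ` block_union p"
  have F: "?F \<subseteq> carrier (padic_int p)" using padic_of_int_in_carrier[of p] p1 by auto
  have "x \<in> ?F" if "x \<in> padic_topology p closure_of ?F" for x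
  proof (rule ccontr)
    assume x: "x \<notin> ?F"
    have carrier: "x \<in> padic_int_carrier p" and ex: "\<exists>y\<in>?F. y n = x n" for n
      using that unfolding padic_in_closure_of_iff[OF p F] by auto
    have down: "y m = x m" if "y n = x n" "m \<le> n" "y \<in> padic_int_carrier p" for y m n
      using that(2,1) by (induction rule: inc_induct)
        (metis padic_int_carrierD(2) carrier that(3))+
    have "padic_of_int p 0 \<in> ?F" by (simp add: block_union_def)
    with x have "x \<noteq> padic_of_int p 0" by metis
    then obtain n where n: "x n \<noteq> 0" by (auto simp: padic_of_int_def)
    \<comment> \<open>Block \<open>k\<close> consists of multiples of \<open>p ^ block_exp k\<close>
      with \<open>block_exp k \<ge> k\<close>, so a nonzero residue modulo \<open>p ^ n\<close>
      occurs only in blocks with \<open>k < n\<close>.\<close>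
    define A where "A = padic_of_int p ` (\<Union>k<n. block p k)"
    have "finite A" by (simp add: A_def block_def)
    have A: "y \<in> A" if y: "y \<in> ?F" "y n \<noteq> 0" for y
    proof -
      obtain a where a: "a \<in> block_union p" "y = padic_of_int p a" using y by blast
      then have nd: "\<not> int p ^ n dvd a" using y by (auto simp: padic_of_int_def)
      then obtain k where k: "a \<in> block p k" using a by (auto simp: block_union_def)
      then have "int p ^ block_exp k dvd a" by (auto simp: block_def)
      then have "block_exp k < n" using nd by (meson le_imp_power_dvd dvd_trans not_le)
      then have "k < n" using block_exp_ge[of k] by simp
      then show ?thesis using k a by (auto simp: A_def)
    qed
    have "A \<subseteq> ?F" by (auto simp: A_def block_union_def)
    have "\<forall>y\<in>A. \<exists>m. y m \<noteq> x m" using x \<open>A \<subseteq> ?F\<close> by (metis ext subsetD)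
    then obtain f where f: "\<And>y. y \<in> A \<Longrightarrow> y (f y) \<noteq> x (f y)" by metis
    \<comment> \<open>At level \<open>m\<close> no point of \<open>A\<close> agrees with
      \<open>x\<close>, while \<open>n \<le> m\<close> forces any point agreeing with
      \<open>x\<close> there into \<open>A\<close>.\<close>
    define m where "m = Max (insert n (f ` A))"
    obtain y where y: "y \<in> ?F" "y m = x m" using ex by blast
    then have yc: "y \<in> padic_int_carrier p" using F by auto
    have "n \<le> m" unfolding m_def using \<open>finite A\<close> by (intro Max_ge) auto
    then have "y n = x n" using down y(2) yc by blast
    then have "y \<in> A" using A y(1) n by simp
    then have "f y \<le> m" unfolding m_def using \<open>finite A\<close> by (intro Max_ge) auto
    then show False using f[OF \<open>y \<in> A\<close>] down y(2) yc by blast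
  qed
  then show ?thesis
    using F by (metis closure_of_subset_eq subsetI topspace_mtopology)
qed

text \<open>On the interval up to \<open>p ^ (Suc k * block_exp k)\<close>, block \<open>k\<close>
  alone gives the logarithmic ratio \<open>k / Suc k\<close>. Such intervals exist beyond every
  length \<open>L\<close>, so each \<open>counting_sup\<close> is at least \<open>1\<close>.\<close>

lemma counting_dim_block_union:
  assumes p: "p > 1"
  shows "1 \<le> counting_dim (block_union p)"
proof -
  have "1 \<le> counting_sup (block_union p) L" for L
  proof -
    have lim: "(\<lambda>k. ereal (real k / real (Suc k))) \<longlonglongrightarrow> ereal 1"
      by (intro tendsto_ereal) real_asymp
    have "ereal (real k / real (Suc k)) \<le> counting_sup (block_union p) L" if k: "k \<ge> max 1 L" for k
    proof -
      define l where "l = Suc k * block_exp k"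
      have "card (block p k) = card {1..int p ^ (k * block_exp k)}"
        unfolding block_def using p by (intro card_image inj_onI) auto
      then have card: "card (block p k) = p ^ (k * block_exp k)"
        by (simp add: nat_power_eq)
      have "block p k \<subseteq> {0<..int p ^ l}"
        using p by (auto simp: block_def l_def power_add mult_left_mono)
      then have "block p k \<subseteq> block_union p \<inter> {0<..int p ^ l}"
        by (auto simp: block_union_def)
      then have "p ^ (k * block_exp k) \<le> card (block_union p \<inter> {0<..int p ^ l})"
        unfolding card[symmetric] by (rule card_mono[rotated]) simp
      note le = elog_mono[OF this]
      have cI: "card {0<..int p ^ l} = p ^ l" by (simp add: nat_power_eq)
      have l_pos: "l > 0" using block_exp_pos[of k] by (simp add: l_def)
      have elogI: "elog (p ^ l) = ereal (real l * ln (real p))"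
        using p by (simp add: elog_def ln_realpow)
      have "real k / real (Suc k)
          = real k * (real (block_exp k) * ln (real p)) / (real (Suc k) * (real (block_exp k) * ln (real p)))"
        using p block_exp_pos[of k] by (intro mult_divide_mult_cancel_right[symmetric]) auto
      then have "real k / real (Suc k) = real (k * block_exp k) * ln (real p) / (real l * ln (real p))"
        by (simp only: l_def of_nat_mult mult.assoc)
      then have "ereal (real k / real (Suc k)) = elog (p ^ (k * block_exp k)) / elog (p ^ l)"
        unfolding elogI using p l_pos by (simp add: elog_def ln_realpow)
      also have "\<dots> \<le> elog (card (block_union p \<inter> {0<..int p ^ l})) / elog (p ^ l)"
        using le l_pos p unfolding elogI by (intro ereal_divide_right_mono) auto
      also have "\<dots> \<le> counting_sup (block_union p) L"
        unfolding counting_sup_def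
      proof (rule Sup_upper, clarify, intro exI conjI)
        \<comment> \<open>The interval is long enough since
          \<open>L \<le> k \<le> block_exp k \<le> l \<le> p ^ l\<close>.\<close>
        have "L \<le> l" using k block_exp_ge[of k] by (simp add: l_def trans_le_add1)
        also have "l \<le> p ^ l" using p by (simp add: power_gt_expt less_imp_le)
        finally show "L \<le> card {0<..int p ^ l}" by (simp only: cI)
      qed (simp only: cI)
      finally show ?thesis .
    qed
    then show ?thesis
      unfolding one_ereal_def by (intro LIMSEQ_le_const2[OF lim]) blast
  qed
  then show ?thesis by (intro LIMSEQ_le_const[OF counting_sup_LIMSEQ]) blast
qed

text \<open>The lower limit is tested only at the scales \<open>block_exp (Suc k)\<close>, just
  before block \<open>Suc k\<close> becomes visible.\<close>

lemma lower_box_dim_block_union: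
  assumes p: "prime p"
  shows "lower_box_dim p (padic_of_int p ` block_union p) \<le> ereal (1 / 2)"
proof -
  have p1: "p > 1" using p by (rule prime_gt_1_nat)
  let ?F = "padic_of_int p ` block_union p"
  have F: "?F \<subseteq> carrier (padic_int p)" using padic_of_int_in_carrier[of p] p1 by auto
  let ?a = "\<lambda>n. elog (padic_covering_number p n ?F) / ereal (real n * ln (real p))"
  have le: "?a (block_exp (Suc k)) \<le> ereal (1 / 2)" for k
  proof -
    define n where "n = block_exp (Suc k)"
    define e where "e = Suc k * block_exp k"
    have n_eq: "n = 4 * e" by (simp add: n_def e_def block_exp_Suc)
    have e_pos: "e > 0" using block_exp_pos[of k] by (simp add: e_def)
    \<comment> \<open>Zero and the blocks after the \<open>k\<close>-th are divisible by
      \<open>p ^ n\<close> and leave residue \<open>0\<close>; the remaining elements are at most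
      \<open>p ^ e\<close>, and reduction does not enlarge them.\<close>
    have "(\<lambda>x. x n) ` ?F \<subseteq> {0..int p ^ e}"
    proof clarify
      fix a assume a: "a \<in> block_union p"
      have "a mod int p ^ n \<in> {0..int p ^ e}"
      proof (cases "int p ^ n dvd a")
        case False
        then obtain i where i: "a \<in> block p i" using a by (auto simp: block_union_def)
        then have "int p ^ block_exp i dvd a" by (auto simp: block_def)
        then have "\<not> n \<le> block_exp i" using False by (meson le_imp_power_dvd dvd_trans)
        then have "i \<le> k" using block_exp_mono[of "Suc k" i] by (force simp: n_def)
        then have "Suc i * block_exp i \<le> e"
          unfolding e_def by (intro mult_le_mono block_exp_mono) auto
        then have "int p ^ (Suc i * block_exp i) \<le> int p ^ e" using p1 by (intro power_increasing) auto
        moreover have "0 \<le> a" "a \<le> int p ^ (Suc i * block_exp i)"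
          using i p1 by (auto simp: block_def power_add mult_left_mono)
        moreover have "0 \<le> a mod int p ^ n" using p1 by simp
        moreover have "a mod int p ^ n \<le> a" using \<open>0 \<le> a\<close> by (rule zmod_le_nonneg_dividend)
        ultimately show ?thesis unfolding atLeastAtMost_iff by linarith
      qed (use p1 in auto)
      then show "padic_of_int p a n \<in> {0..int p ^ e}" by (simp add: padic_of_int_def)
    qed
    then have "card ((\<lambda>x. x n) ` ?F) \<le> card {0..int p ^ e}" by (intro card_mono) auto
    also have "\<dots> = p ^ e + 1" by (simp add: nat_add_distrib nat_power_eq)
    \<comment> \<open>Squaring absorbs the extra residue \<open>0\<close> crudely. Since
      \<open>n = 4 * e\<close>, the exponent \<open>2 * e\<close> still gives the ratio
      \<open>1 / 2\<close>.\<close>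
    also have "\<dots> \<le> p ^ e * p ^ e"
    proof -
      have "2 \<le> p ^ e" using p1 e_pos by (metis One_nat_def Suc_leI one_less_power Suc_1)
      then have "2 * p ^ e \<le> p ^ e * p ^ e" by (rule mult_le_mono1)
      then show ?thesis using \<open>2 \<le> p ^ e\<close> by linarith
    qed
    finally have "padic_covering_number p n ?F \<le> p ^ (2 * e)"
      by (simp add: padic_covering_number_eq_card[OF p F] power_add mult_2)
    from elog_mono[OF this] have "elog (padic_covering_number p n ?F) \<le> ereal (real (2 * e) * ln (real p))"
      using p1 by (simp add: elog_def ln_realpow)
    then show ?thesis
      using e_pos p1 unfolding n_def[symmetric]
      by (subst ereal_divide_le_pos) (auto simp: n_eq mult.assoc)
  qed
  \<comment> \<open>Strict monotonicity makes these scales a subsequence, whose lower limit is an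
    upper bound for the full one.\<close>
  have "strict_mono (\<lambda>k. block_exp (Suc k))"
    using block_exp_pos by (intro strict_mono_Suc_iff[THEN iffD2] allI) (simp add: block_exp_Suc[of "Suc _"])
  then have "liminf ?a \<le> liminf (?a \<circ> (\<lambda>k. block_exp (Suc k)))"
    by (rule liminf_subseq_mono)
  also have "\<dots> \<le> ereal (1 / 2)"
    by (rule Liminf_le) (use le in \<open>auto simp: eventually_sequentially\<close>)
  finally show ?thesis unfolding lower_box_dim_def .
qed

theorem theoremE:
  shows "(\<forall>p::nat. prime p \<longrightarrow>
            (\<forall>F \<subseteq> carrier (padic_int p).
               counting_dim {k. padic_of_int p k \<in> padic_topology p closure_of F}
                 \<le> upper_box_dim p F))
       \<and> (\<forall>p::nat. prime p \<longrightarrow>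
            (\<forall>E::int set. counting_dim E \<le> upper_box_dim p (padic_of_int p ` E)))
       \<and> (\<exists>F. closedin (padic_topology 5) F
            \<and> counting_dim {k. padic_of_int 5 k \<in> F} = upper_box_dim 5 F
            \<and> upper_box_dim 5 F > lower_box_dim 5 F
            \<and> lower_box_dim 5 F \<ge> padic_hausdorff_dim 5 F)"
proof (intro conjI allI impI)
  fix p :: nat and F assume p: "prime p" and F: "F \<subseteq> carrier (padic_int p)"
  show "counting_dim {k. padic_of_int p k \<in> padic_topology p closure_of F} \<le> upper_box_dim p F"
  proof (rule counting_dim_le_upper_box_dim[OF p F])
    fix k n assume "k \<in> {k. padic_of_int p k \<in> padic_topology p closure_of F}"
    then obtain y where "y \<in> F" "y n = padic_of_int p k n"
      unfolding mem_Collect_eq padic_in_closure_of_iff[OF p F] by blast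
    then have "k mod int p ^ n = y n" by (simp add: padic_of_int_def)
    with \<open>y \<in> F\<close> show "k mod int p ^ n \<in> (\<lambda>x. x n) ` F" by blast
  qed
next
  fix p :: nat and E :: "int set" assume p: "prime p"
  \<comment> \<open>The residues of \<open>E\<close> are those of its image, so the general
    inequality applies directly, without passing to the closure.\<close>
  show "counting_dim E \<le> upper_box_dim p (padic_of_int p ` E)"
    by (rule counting_dim_le_upper_box_dim[OF p])
      (use padic_of_int_in_carrier[OF prime_gt_0_nat[OF p]] in \<open>auto simp: padic_of_int_def image_image\<close>)
next
  have p: "prime (5::nat)" by simp
  interpret Metric_space "carrier (padic_int 5)" "padic_dist 5" by (rule padic_metric_space[OF p])
  let ?E = "block_union 5" and ?F = "padic_of_int 5 ` block_union 5"
  have F: "?F \<subseteq> carrier (padic_int 5)" using padic_of_int_in_carrier[of 5] by auto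
  have ne: "?F \<noteq> {}" by (simp add: block_union_def)
  have E: "{k. padic_of_int 5 k \<in> ?F} = ?E"
    using padic_of_int_inj[of 5] by (auto dest: injD)
  \<comment> \<open>Both dimensions are squeezed to \<open>1\<close> by the chain
    \<open>1 \<le> counting_dim ?E \<le> upper_box_dim 5 ?F \<le> 1\<close>.\<close>
  have "counting_dim ?E \<le> upper_box_dim 5 ?F"
    by (rule counting_dim_le_upper_box_dim[OF p F]) (auto simp: padic_of_int_def image_image)
  moreover have "upper_box_dim 5 ?F \<le> 1" by (rule upper_box_dim_le_1[OF p F])
  moreover have "1 \<le> counting_dim ?E" by (rule counting_dim_block_union) simp
  ultimately have eq: "counting_dim ?E = 1" "upper_box_dim 5 ?F = 1" by auto
  have "lower_box_dim 5 ?F < 1"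
    using lower_box_dim_block_union[OF p] by (rule le_less_trans) (simp add: one_ereal_def)
  \<comment> \<open>The value \<open>0\<close> separates the two: countability bounds the Hausdorff
    dimension above, nonemptiness the lower box dimension below.\<close>
  moreover have "padic_hausdorff_dim 5 ?F \<le> lower_box_dim 5 ?F"
    unfolding padic_hausdorff_dim_def
    using hausdorff_dim_countable[OF F] lower_box_dim_nonneg[OF p F ne]
    by (meson countable_image countableI_type order_trans)
  ultimately show "\<exists>F. closedin (padic_topology 5) F
      \<and> counting_dim {k. padic_of_int 5 k \<in> F} = upper_box_dim 5 F
      \<and> upper_box_dim 5 F > lower_box_dim 5 F
      \<and> lower_box_dim 5 F \<ge> padic_hausdorff_dim 5 F"
    using closedin_block_union[OF p] eq E by (intro exI[of _ ?F]) simp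
qed

end
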